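(* Let $(a,b,c)\in\mathbb R^3$ be a seed. (1) If $a\ge b\ge c>0$, then for each of the triplets $(e,13,123)$, $(e,e,13)$, $(e,13,13)$, $(e,23,13)$, $(e,23,123)$, $(e,123,13)$, $(e,123,123)$, $(e,132,13)$, $(e,132,123)$, the maximal terms of the generalized TRIP-Stern tree with seed $(a,b,c)$ lie on the path obtained by always selecting the right edge: for every $n\ge0$, $m_n$ equals the largest entry of $(a,b,c)F_1^n$. (2) If $0<a\le b\le c$, then for each of the triplets $(e,e,e)$, $(e,e,12)$, $(e,e,23)$, $(e,e,123)$, $(e,e,132)$, $(e,12,e)$, $(e,12,12)$, $(e,12,13)$, $(e,12,23)$, $(e,12,123)$, $(e,12,132)$, the maximal terms of the generalized TRIP-Stern tree with seed $(a,b,c)$ lie on the path obtained by always selecting the left edge: for every $n\ge0$, $m_n$ equals the largest entry of $(a,b,c)F_0^n$.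
   Context: Let $A_0=\begin{pmatrix}0&0&1\\1&0&0\\0&1&1\end{pmatrix}$, $A_1=\begin{pmatrix}1&0&1\\0&1&0\\0&0&1\end{pmatrix}$. Elements of $S_3$ are identified with permutation matrices: $e=I$, $(12)=\begin{pmatrix}0&1&0\\1&0&0\\0&0&1\end{pmatrix}$, $(13)=\begin{pmatrix}0&0&1\\0&1&0\\1&0&0\end{pmatrix}$, $(23)=\begin{pmatrix}1&0&0\\0&0&1\\0&1&0\end{pmatrix}$, $(123)=\begin{pmatrix}0&1&0\\0&0&1\\1&0&0\end{pmatrix}$, $(132)=\begin{pmatrix}0&0&1\\1&0&0\\0&1&0\end{pmatrix}$. For $(\sigma,\tau_0,\tau_1)\in S_3^3$ put $F_0=\sigma A_0\tau_0$, $F_1=\sigma A_1\tau_1$. The generalized TRIP-Stern tree with seed $(a,b,c)$ is the binary tree with root $(a,b,c)$ in which the left child of $x$ is $xF_0$ and the right child is $xF_1$; level $n$ consists of $\triangle(v)=(a,b,c)F_{i_1}\cdots F_{i_n}=(b_1(v),b_2(v),b_3(v))$ for $v=(i_1,\dots,i_n)\in\{0,1\}^n$. The maximal entry of level $n$ is $m_n=\max_{|v|=n}\max_i b_i(v)$. *)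

theory Defs
  imports "HOL-Analysis.Analysis"
begin

datatype s3 = Id3 | P12 | P13 | P23 | P123 | P132

text \<open>Matrices are written row by row.\<close>

fun perm_matrix :: "s3 \<Rightarrow> real ^ 3 ^ 3" where
  "perm_matrix Id3 = mat 1"
| "perm_matrix P12 = vector [vector [0, 1, 0], vector [1, 0, 0], vector [0, 0, 1]]"
| "perm_matrix P13 = vector [vector [0, 0, 1], vector [0, 1, 0], vector [1, 0, 0]]"
| "perm_matrix P23 = vector [vector [1, 0, 0], vector [0, 0, 1], vector [0, 1, 0]]"
| "perm_matrix P123 = vector [vector [0, 1, 0], vector [0, 0, 1], vector [1, 0, 0]]"
| "perm_matrix P132 = vector [vector [0, 0, 1], vector [1, 0, 0], vector [0, 1, 0]]"

definition trip_A0 :: "real ^ 3 ^ 3" where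
  "trip_A0 = vector [vector [0, 0, 1], vector [1, 0, 0], vector [0, 1, 1]]"

definition trip_A1 :: "real ^ 3 ^ 3" where
  "trip_A1 = vector [vector [1, 0, 1], vector [0, 1, 0], vector [0, 0, 1]]"

type_synonym triplet = "s3 \<times> s3 \<times> s3"

fun trip_F0 :: "triplet \<Rightarrow> real ^ 3 ^ 3" where
  "trip_F0 (\<sigma>, \<tau>0, \<tau>1) = perm_matrix \<sigma> ** trip_A0 ** perm_matrix \<tau>0"

fun trip_F1 :: "triplet \<Rightarrow> real ^ 3 ^ 3" where
  "trip_F1 (\<sigma>, \<tau>0, \<tau>1) = perm_matrix \<sigma> ** trip_A1 ** perm_matrix \<tau>1"

definition trip_F :: "triplet \<Rightarrow> nat \<Rightarrow> real ^ 3 ^ 3" where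
  "trip_F t i = (if i = 0 then trip_F0 t else trip_F1 t)"

text \<open>A vertex of level \<open>n\<close> is a word of length \<open>n\<close> over \<open>{0, 1}\<close>, read from the root;
  \<open>0\<close> selects the left edge and \<open>1\<close> the right edge. Triples are row vectors.\<close>

definition level_words :: "nat \<Rightarrow> nat list set" where
  "level_words n = {v. set v \<subseteq> {0, 1} \<and> length v = n}"

definition tree_node :: "triplet \<Rightarrow> real ^ 3 \<Rightarrow> nat list \<Rightarrow> real ^ 3" where
  "tree_node t s v = foldl (\<lambda>x i. x v* trip_F t i) s v"

definition max_entry :: "real ^ 3 \<Rightarrow> real" where
  "max_entry x = Max (range (\<lambda>i. x $ i))"

definition level_max :: "triplet \<Rightarrow> real ^ 3 \<Rightarrow> nat \<Rightarrow> real" where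
  "level_max t s n = Max ((\<lambda>v. max_entry (tree_node t s v)) ` level_words n)"

text \<open>On \<open>real ^ 3 ^ 3\<close> the type-class product is componentwise, so \<open>^\<close> is not the matrix power.\<close>

primrec mat_power :: "real ^ 'n ^ 'n \<Rightarrow> nat \<Rightarrow> real ^ 'n ^ 'n" where
  "mat_power A 0 = mat 1"
| "mat_power A (Suc n) = mat_power A n ** A"

end

theory Submission
  imports Defs
begin

text \<open>
  Let \<open>k\<close> be the edge whose constant path is claimed to be maximal. For each triplet there is a
  relation between triples, given by a few linear inequalities, that holds between a suitably sorted
  positive seed and itself, makes the entries of its first argument at most the largest entry of
  the second, and is preserved when the first argument moves along an arbitrary edge while the
  second one moves along \<open>k\<close>. The entry created at each step is \<open>x\<^sub>1 + x\<^sub>3\<close>, so this sum has to be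
  dominated together with the entries. This is enough when the path \<open>k\<close> obeys a Fibonacci
  recursion; when it obeys a recursion of order three, the sum of all entries, and for
  some triplets a further linear form, has to be dominated as well.
\<close>

lemma finite_level_words: "finite (level_words n)"
  unfolding level_words_def by (rule finite_lists_length_eq) simp

lemma tree_node_replicate:
  "tree_node t s (replicate n k) = s v* mat_power (trip_F t k) n"
proof (induction n)
  case 0
  show ?case by (simp add: tree_node_def)
next
  case (Suc n)
  \<comment> \<open>The last edge is split off, not the first, because \<open>mat_power\<close>
    gains its new factor on the right.\<close>
  have "replicate (Suc n) k = replicate n k @ [k]"
    by (simp add: replicate_append_same)
  with Suc show ?case
    by (simp add: tree_node_def vector_matrix_mul_assoc del: replicate_Suc)
qed

lemma max_entry_le_iff: "max_entry x \<le> m \<longleftrightarrow> (\<forall>i. x $ i \<le> m)"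
  by (simp add: max_entry_def)

lemma entry_le_max_entry: "x $ i \<le> max_entry x"
  using max_entry_le_iff by blast

lemma tree_node_invariant:
  assumes "R s s'"
    and step: "\<And>x y i. R x y \<Longrightarrow> i \<in> {0, 1} \<Longrightarrow> R (x v* trip_F t i) (y v* trip_F t k)"
    and "v \<in> level_words n"
  shows "R (tree_node t s v) (tree_node t s' (replicate n k))"
proof -
  have "set v \<subseteq> {0, 1} \<Longrightarrow> R (tree_node t s v) (tree_node t s' (replicate (length v) k))"
    using assms(1)
  proof (induction v arbitrary: s s')
    case Nil
    then show ?case by (simp add: tree_node_def)
  next
    case (Cons i v)
    then show ?case
      using step [of s s' i] by (simp add: tree_node_def)
  qed
  with assms(3) show ?thesis by (auto simp: level_words_def)
qed

text \<open>The constant path ends in a node of the level, so its largest entry is attained there;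
  \<open>R\<close> relates every other node to that one, and \<open>bound\<close> compares with the
  single entry \<open>y $ j\<close>.\<close>

lemma level_max_eq_path:
  assumes "R s s" and "k \<in> {0, 1}"
    and step: "\<And>x y i. R x y \<Longrightarrow> i \<in> {0, 1} \<Longrightarrow> R (x v* trip_F t i) (y v* trip_F t k)"
    and bound: "\<And>x y i. R x y \<Longrightarrow> x $ i \<le> y $ j"
  shows "level_max t s n = max_entry (s v* mat_power (trip_F t k) n)"
proof -
  let ?p = "tree_node t s (replicate n k)"
  have "replicate n k \<in> level_words n"
    using assms(2) by (auto simp: level_words_def)
  moreover have "max_entry (tree_node t s v) \<le> max_entry ?p" if "v \<in> level_words n" for v
  proof -
    have "R (tree_node t s v) ?p"
      by (rule tree_node_invariant [where R = R, OF assms(1) step that])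
    then show ?thesis
      using bound entry_le_max_entry order_trans unfolding max_entry_le_iff by blast
  qed
  ultimately have "level_max t s n = max_entry ?p"
    unfolding level_max_def by (intro Max_eqI) (auto simp: finite_level_words)
  then show ?thesis by (simp add: tree_node_replicate)
qed

text \<open>Here \<open>x\<close> is an arbitrary node and \<open>y\<close> the node of the constant
  path on the same level; \<open>j\<close> is the position where the path's edge puts the entry it
  creates.\<close>

definition dominated :: "3 \<Rightarrow> real ^ 3 \<Rightarrow> real ^ 3 \<Rightarrow> bool" where
  "dominated j x y \<longleftrightarrow> (\<forall>i. 0 \<le> x $ i \<and> 0 \<le> y $ i \<and> x $ i \<le> y $ j) \<and> x $ 1 + x $ 3 \<le> y $ 1 + y $ 3"

definition sum_dominated :: "3 \<Rightarrow> real ^ 3 \<Rightarrow> real ^ 3 \<Rightarrow> bool" where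
  "sum_dominated j x y \<longleftrightarrow> dominated j x y \<and> (\<Sum>i\<in>UNIV. x $ i) \<le> (\<Sum>i\<in>UNIV. y $ i)"

text \<open>On an order-three path the sum of all entries of \<open>y\<close> is the next value of
  \<open>y $ 1 + y $ 3\<close>. An edge off the path may put the new entry
  \<open>x $ 1 + x $ 3\<close> and the old \<open>x $ l\<close> at positions 1 and 3, whence the
  left-hand side.\<close>

definition weighted_dominated :: "3 \<Rightarrow> 3 \<Rightarrow> real ^ 3 \<Rightarrow> real ^ 3 \<Rightarrow> bool" where
  "weighted_dominated l j x y \<longleftrightarrow>
    sum_dominated j x y \<and> x $ 1 + x $ 3 + x $ l \<le> (\<Sum>i\<in>UNIV. y $ i)"

lemmas dominated_defs = weighted_dominated_def sum_dominated_def dominated_def forall_3 sum_3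

lemma vec_mult_A0: "x v* trip_A0 = vector [x $ 2, x $ 3, x $ 1 + x $ 3]"
  by (simp add: trip_A0_def vec_eq_iff forall_3 vector_matrix_mult_def sum_3)

lemma vec_mult_A1: "x v* trip_A1 = vector [x $ 1, x $ 2, x $ 1 + x $ 3]"
  by (simp add: trip_A1_def vec_eq_iff forall_3 vector_matrix_mult_def sum_3)

lemma vec_mult_perm_matrix:
  "x v* perm_matrix P12 = vector [x $ 2, x $ 1, x $ 3]"
  "x v* perm_matrix P13 = vector [x $ 3, x $ 2, x $ 1]"
  "x v* perm_matrix P23 = vector [x $ 1, x $ 3, x $ 2]"
  "x v* perm_matrix P123 = vector [x $ 3, x $ 1, x $ 2]"
  "x v* perm_matrix P132 = vector [x $ 2, x $ 3, x $ 1]"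
  by (simp_all add: vec_eq_iff forall_3 vector_matrix_mult_def sum_3)

text \<open>All triplets in question have \<sigma> = e, so an edge is \<open>trip_A0\<close> or
  \<open>trip_A1\<close> followed by a permutation of coordinates, and each invariance claim becomes
  linear arithmetic.\<close>

lemma vec_mult_trip_F:
  "x v* trip_F (Id3, \<tau>0, \<tau>1) i =
    (if i = 0 then x v* trip_A0 v* perm_matrix \<tau>0 else x v* trip_A1 v* perm_matrix \<tau>1)"
  by (simp add: trip_F_def vector_matrix_mul_assoc)

lemmas vec_mult_simps =
  vec_mult_trip_F vec_mult_A0 vec_mult_A1 perm_matrix.simps(1) vec_mult_perm_matrix

text \<open>The path's edge gives \<open>(y\<^sub>1 + y\<^sub>3, y\<^sub>2, y\<^sub>1)\<close>. Any
  two entries of a child of \<open>x\<close> add up to at most \<open>x\<^sub>1 + x\<^sub>3\<close>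
  plus one old entry, hence to at most \<open>(y\<^sub>1 + y\<^sub>3) + y\<^sub>1\<close>; so
  \<open>\<tau>0\<close> is arbitrary.\<close>

lemma dominated_step_right:
  assumes "dominated 1 x y" and "i \<in> {0, 1}"
  shows "dominated 1 (x v* trip_F (Id3, \<tau>0, P13) i) (y v* trip_F (Id3, \<tau>0, P13) 1)"
  using assms by (cases \<tau>0) (auto simp: dominated_defs vec_mult_simps simp del: perm_matrix.simps(2-))

lemma weighted_dominated_step_right:
  assumes "weighted_dominated 3 1 x y" and "i \<in> {0, 1}" and "\<tau>0 \<in> {P13, P23, P123, P132}"
  shows "weighted_dominated 3 1 (x v* trip_F (Id3, \<tau>0, P123) i) (y v* trip_F (Id3, \<tau>0, P123) 1)"
  using assms by (auto simp: dominated_defs vec_mult_simps simp del: perm_matrix.simps(2-))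

text \<open>The path's edge gives \<open>(y\<^sub>3, y\<^sub>2, y\<^sub>1 + y\<^sub>3)\<close>; the
  estimate is that of \<open>dominated_step_right\<close> with \<open>y\<^sub>3\<close> in place of
  \<open>y\<^sub>1\<close> as the bound for old entries.\<close>

lemma dominated_step_left:
  assumes "dominated 3 x y" and "i \<in> {0, 1}"
  shows "dominated 3 (x v* trip_F (Id3, P12, \<tau>1) i) (y v* trip_F (Id3, P12, \<tau>1) 0)"
  using assms by (cases \<tau>1) (auto simp: dominated_defs vec_mult_simps simp del: perm_matrix.simps(2-))

text \<open>The right edge gives \<open>(x\<^sub>1 + x\<^sub>3, x\<^sub>1, x\<^sub>2)\<close>, whose
  entries 1 and 3 add up to the full sum of \<open>x\<close>. \<open>P123\<close> is treated apart
  because it puts the new entry at position 1, which the weighted form would count twice.\<close>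

lemma sum_dominated_step_left:
  assumes "sum_dominated 3 x y" and "i \<in> {0, 1}"
  shows "sum_dominated 3 (x v* trip_F (Id3, Id3, P123) i) (y v* trip_F (Id3, Id3, P123) 0)"
  using assms by (auto simp: dominated_defs vec_mult_simps simp del: perm_matrix.simps(2-))

text \<open>These \<open>\<tau>1\<close> put the new entry at position 2 or 3, so the weighted form
  counts it at most once. For \<open>Id3\<close>, for instance, it becomes
  \<open>(2 * x\<^sub>1 + x\<^sub>3) + x\<^sub>1\<close>, at most the full sum of \<open>y\<close>
  plus \<open>y\<^sub>3\<close>.\<close>

lemma weighted_dominated_step_left:
  assumes "weighted_dominated 1 3 x y" and "i \<in> {0, 1}" and "\<tau>1 \<in> {Id3, P12, P23, P132}"
  shows "weighted_dominated 1 3 (x v* trip_F (Id3, Id3, \<tau>1) i) (y v* trip_F (Id3, Id3, \<tau>1) 0)"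
  using assms by (auto simp: dominated_defs vec_mult_simps simp del: perm_matrix.simps(2-))

lemma dominated_entry:
  "dominated j x y \<Longrightarrow> x $ i \<le> y $ j"
  "sum_dominated j x y \<Longrightarrow> x $ i \<le> y $ j"
  "weighted_dominated l j x y \<Longrightarrow> x $ i \<le> y $ j"
  by (simp_all add: weighted_dominated_def sum_dominated_def dominated_def)

lemma trip_F_0: "trip_F t 0 = trip_F0 t" and trip_F_1: "trip_F t 1 = trip_F1 t"
  by (simp_all add: trip_F_def)

lemma level_max_right:
  assumes "a \<ge> b" "b \<ge> c" "c > 0"
    and "\<tau>1 = P13 \<or> \<tau>1 = P123 \<and> \<tau>0 \<in> {P13, P23, P123, P132}"
  shows "level_max (Id3, \<tau>0, \<tau>1) (vector [a, b, c]) n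
    = max_entry (vector [a, b, c] v* mat_power (trip_F1 (Id3, \<tau>0, \<tau>1)) n)"
  using assms(4)
proof
  assume t: "\<tau>1 = P13"
  have "dominated 1 (vector [a, b, c]) (vector [a, b, c])"
    using assms(1-3) by (simp add: dominated_defs)
  from level_max_eq_path [where R = "dominated 1", OF this _ dominated_step_right dominated_entry(1)]
  show ?thesis unfolding t trip_F_1 by simp
next
  assume t: "\<tau>1 = P123 \<and> \<tau>0 \<in> {P13, P23, P123, P132}"
  \<comment> \<open>The weighted inequality reads \<open>a + 2 * c \<le> a + b + c\<close>, which is
    \<open>c \<le> b\<close>.\<close>
  have "weighted_dominated 3 1 (vector [a, b, c]) (vector [a, b, c])"
    using assms(1-3) by (simp add: dominated_defs)
  from level_max_eq_path [where R = "weighted_dominated 3 1",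
      OF this _ weighted_dominated_step_right dominated_entry(3)]
  show ?thesis using t unfolding trip_F_1 by simp
qed

lemma level_max_left:
  assumes "0 < a" "a \<le> b" "b \<le> c"
    and "\<tau>0 = P12 \<or> \<tau>0 = Id3 \<and> \<tau>1 \<noteq> P13"
  shows "level_max (Id3, \<tau>0, \<tau>1) (vector [a, b, c]) n
    = max_entry (vector [a, b, c] v* mat_power (trip_F0 (Id3, \<tau>0, \<tau>1)) n)"
proof -
  let ?s = "vector [a, b, c] :: real ^ 3"
  \<comment> \<open>The weighted inequality reads \<open>2 * a + c \<le> a + b + c\<close>, which is
    \<open>a \<le> b\<close>.\<close>
  have s: "dominated 3 ?s ?s" "sum_dominated 3 ?s ?s" "weighted_dominated 1 3 ?s ?s"
    using assms(1-3) by (simp_all add: dominated_defs)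
  consider "\<tau>0 = P12" | "\<tau>0 = Id3" "\<tau>1 = P123" | "\<tau>0 = Id3" "\<tau>1 \<in> {Id3, P12, P23, P132}"
    using assms(4) by (cases \<tau>1) auto
  then show ?thesis
  proof cases
    case 1
    from level_max_eq_path [where R = "dominated 3",
        OF s(1) _ dominated_step_left dominated_entry(1)]
    show ?thesis unfolding 1 trip_F_0 by simp
  next
    case 2
    from level_max_eq_path [where R = "sum_dominated 3",
        OF s(2) _ sum_dominated_step_left dominated_entry(2)]
    show ?thesis unfolding 2 trip_F_0 by simp
  next
    case 3
    from level_max_eq_path [where R = "weighted_dominated 1 3",
        OF s(3) _ weighted_dominated_step_left dominated_entry(3)]
    show ?thesis using 3 unfolding trip_F_0 by simp
  qed
qed

theorem theorem41:
  fixes a b c :: real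
  shows "(a \<ge> b \<and> b \<ge> c \<and> c > 0 \<longrightarrow>
      (\<forall>t \<in> {(Id3, P13, P123), (Id3, Id3, P13), (Id3, P13, P13), (Id3, P23, P13),
              (Id3, P23, P123), (Id3, P123, P13), (Id3, P123, P123), (Id3, P132, P13),
              (Id3, P132, P123)}.
        \<forall>n. level_max t (vector [a, b, c]) n
            = max_entry (vector [a, b, c] v* mat_power (trip_F1 t) n)))
    \<and> (0 < a \<and> a \<le> b \<and> b \<le> c \<longrightarrow>
      (\<forall>t \<in> {(Id3, Id3, Id3), (Id3, Id3, P12), (Id3, Id3, P23), (Id3, Id3, P123),
              (Id3, Id3, P132), (Id3, P12, Id3), (Id3, P12, P12), (Id3, P12, P13),
              (Id3, P12, P23), (Id3, P12, P123), (Id3, P12, P132)}.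
        \<forall>n. level_max t (vector [a, b, c]) n
            = max_entry (vector [a, b, c] v* mat_power (trip_F0 t) n)))"
  by (auto intro!: level_max_right level_max_left simp del: trip_F0.simps trip_F1.simps)

end
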